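(* Let $D\subset\mathbb{R}^2$ be the closed unit disc with the Euclidean metric, and let $X$ be the $\ell_\infty$ sum of $D$ and $[0,1]$. Then, in the lion and man game on $X$ with the man starting at $(0,0)$ and the lion starting at $(0,1)$ (where the first coordinate $0$ denotes the centre of $D$), the lion has a winning strategy and the man also has a winning strategy.
   Context: The $\ell_\infty$ sum of metric spaces $X_1,X_2$ is $X_1\times X_2$ with metric $d((x,y),(x',y'))=\max(d(x,x'),d(y,y'))$. Lion and man game on a metric space $X$ with starting points $x_0$ (lion) and $y_0$ (man), $x_0\ne y_0$. A lion path is a function $l:[0,\infty)\to X$ with $d(l(s),l(t))\le |s-t|$ for all $s,t$ and $l(0)=x_0$; a man path is a function $m:[0,\infty)\to X$ with $d(m(s),m(t))\le|s-t|$ for all $s,t$ and $m(0)=y_0$. Let $L$ be the set of lion paths and $M$ the set of man paths. A lion strategy is a function $G:M\to L$ such that if $m,m'\in M$ agree on $[0,t]$ then $G(m)$ and $G(m')$ agree on $[0,t]$. A man strategy is a function $F:L\to M$ such that if $l,l'\in L$ agree on $[0,t]$ then $F(l)$ and $F(l')$ agree on $[0,t]$. A lion strategy $G$ is winning if for every $m\in M$ there is $t\ge 0$ with $G(m)(t)=m(t)$. A man strategy $F$ is winning if for every $l\in L$ and every $t\ge0$ we have $F(l)(t)\neq l(t)$. *)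

theory Defs
  imports "HOL-Analysis.Analysis"
begin

definition linf_dist ::
  "('a \<Rightarrow> 'a \<Rightarrow> real) \<Rightarrow> ('b \<Rightarrow> 'b \<Rightarrow> real) \<Rightarrow> 'a \<times> 'b \<Rightarrow> 'a \<times> 'b \<Rightarrow> real"
  where "linf_dist d1 d2 p q = max (d1 (fst p) (fst q)) (d2 (snd p) (snd q))"

lemma Metric_space_linf_dist:
  assumes "Metric_space X1 d1" and "Metric_space X2 d2"
  shows "Metric_space (X1 \<times> X2) (linf_dist d1 d2)"
proof -
  interpret A: Metric_space X1 d1 by fact
  interpret B: Metric_space X2 d2 by fact
  show ?thesis
  proof
    fix p q r
    show "0 \<le> linf_dist d1 d2 p q"
      by (simp add: linf_dist_def le_max_iff_disj)
    show "linf_dist d1 d2 p q = linf_dist d1 d2 q p"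
      by (simp add: linf_dist_def A.commute B.commute)
    assume p: "p \<in> X1 \<times> X2" and q: "q \<in> X1 \<times> X2"
    show "linf_dist d1 d2 p q = 0 \<longleftrightarrow> p = q"
    proof
      assume 0: "linf_dist d1 d2 p q = 0"
      have "d1 (fst p) (fst q) = 0" "d2 (snd p) (snd q) = 0"
        using 0 A.nonneg[of "fst p" "fst q"] B.nonneg[of "snd p" "snd q"]
        unfolding linf_dist_def by linarith+
      then show "p = q"
        using p q by (auto simp: prod_eq_iff)
    next
      assume "p = q"
      then show "linf_dist d1 d2 p q = 0"
        using p by (auto simp: linf_dist_def)
    qed
    assume r: "r \<in> X1 \<times> X2"
    show "linf_dist d1 d2 p r \<le> linf_dist d1 d2 p q + linf_dist d1 d2 q r"
      using p q r A.triangle[of "fst p" "fst q" "fst r"]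
        B.triangle[of "snd p" "snd q" "snd r"]
      by (auto simp: linf_dist_def)
  qed
qed

text \<open>
  In what follows a metric space is given by a carrier X and a distance d, as in the
  locale \<^locale>\<open>Metric_space\<close>. Time ranges over the nonnegative reals; paths are
  extensional, so that a path is determined by its values at nonnegative times.
\<close>

definition game_paths :: "'a set \<Rightarrow> ('a \<Rightarrow> 'a \<Rightarrow> real) \<Rightarrow> 'a \<Rightarrow> (real \<Rightarrow> 'a) set"
  where "game_paths X d p =
    {l \<in> {0..} \<rightarrow>\<^sub>E X. l 0 = p \<and> (\<forall>s\<ge>0. \<forall>t\<ge>0. d (l s) (l t) \<le> \<bar>s - t\<bar>)}"

definition agree_upto :: "real \<Rightarrow> (real \<Rightarrow> 'a) \<Rightarrow> (real \<Rightarrow> 'a) \<Rightarrow> bool"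
  where "agree_upto t f g \<longleftrightarrow> (\<forall>s\<in>{0..t}. f s = g s)"

definition non_anticipating ::
  "(real \<Rightarrow> 'a) set \<Rightarrow> ((real \<Rightarrow> 'a) \<Rightarrow> (real \<Rightarrow> 'a)) \<Rightarrow> bool"
  where "non_anticipating P S \<longleftrightarrow>
    (\<forall>p\<in>P. \<forall>q\<in>P. \<forall>t\<ge>0. agree_upto t p q \<longrightarrow> agree_upto t (S p) (S q))"

text \<open>Throughout, x0 is the starting point of the lion and y0 that of the man.\<close>

definition lion_strategy ::
  "'a set \<Rightarrow> ('a \<Rightarrow> 'a \<Rightarrow> real) \<Rightarrow> 'a \<Rightarrow> 'a \<Rightarrow> ((real \<Rightarrow> 'a) \<Rightarrow> (real \<Rightarrow> 'a)) \<Rightarrow> bool"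
  where "lion_strategy X d x0 y0 G \<longleftrightarrow>
    G \<in> game_paths X d y0 \<rightarrow> game_paths X d x0 \<and> non_anticipating (game_paths X d y0) G"

definition man_strategy ::
  "'a set \<Rightarrow> ('a \<Rightarrow> 'a \<Rightarrow> real) \<Rightarrow> 'a \<Rightarrow> 'a \<Rightarrow> ((real \<Rightarrow> 'a) \<Rightarrow> (real \<Rightarrow> 'a)) \<Rightarrow> bool"
  where "man_strategy X d x0 y0 F \<longleftrightarrow>
    F \<in> game_paths X d x0 \<rightarrow> game_paths X d y0 \<and> non_anticipating (game_paths X d x0) F"

definition winning_lion_strategy ::
  "'a set \<Rightarrow> ('a \<Rightarrow> 'a \<Rightarrow> real) \<Rightarrow> 'a \<Rightarrow> 'a \<Rightarrow> ((real \<Rightarrow> 'a) \<Rightarrow> (real \<Rightarrow> 'a)) \<Rightarrow> bool"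
  where "winning_lion_strategy X d x0 y0 G \<longleftrightarrow>
    lion_strategy X d x0 y0 G \<and> (\<forall>m\<in>game_paths X d y0. \<exists>t\<ge>0. G m t = m t)"

definition winning_man_strategy ::
  "'a set \<Rightarrow> ('a \<Rightarrow> 'a \<Rightarrow> real) \<Rightarrow> 'a \<Rightarrow> 'a \<Rightarrow> ((real \<Rightarrow> 'a) \<Rightarrow> (real \<Rightarrow> 'a)) \<Rightarrow> bool"
  where "winning_man_strategy X d x0 y0 F \<longleftrightarrow>
    man_strategy X d x0 y0 F \<and> (\<forall>l\<in>game_paths X d x0. \<forall>t\<ge>0. F l t \<noteq> l t)"

end

theory Submission
  imports Defs
begin

text \<open>
  The lion wins by shadowing the man in the disc, which is possible because the two factors of
  an \<open>\<ell>\<^sub>\<infinity>\<close> sum impose separate speed limits, while sinking from height 1 to height 0 at unit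
  speed: by the intermediate value theorem their heights coincide at some time in \<open>[0, 1]\<close>.

  The man stays at height 0, so that only the distinct heights at time 0 are used by him: at
  every later time he already differs from the lion in the disc, where both start at the centre.
  As a strategy may look at the lion's path on \<open>[0, t]\<close> before the man's position at time \<open>t\<close> is
  fixed, at every \<open>t > 0\<close> it may depend on the germ of that path at 0. Fix a unit vector \<open>e\<close>; the man
  first runs along \<open>e\<close>, unless the lion starts out exactly along \<open>e\<close>, when he runs along \<open>-e\<close>. A
  path of speed at most 1 can reach \<open>t e\<close> at time \<open>t\<close> only by running straight there, so the two
  positions in the disc differ at every positive time of this run (\<open>first_heading_avoids\<close>). This
  discontinuous dependence on the lion's path is why both players can have winning strategies.

  From then on the man follows Besicovitch's strategy in the disc: in the \<open>n\<close>-th leg he runs a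
  distance \<open>1 / (n + 2)\<close> at right angles to his position vector, turning to the side on which
  the lion is not. A pursuer behind a straight runner of full speed never catches him
  (\<open>straight_run_avoids\<close>). The squares of the leg lengths add up to the square of his
  distance from the centre, which therefore stays below 1, but the lengths
  themselves have an infinite sum, so that the legs fill all time.

  The first run is treated as leg 0 of the same polygonal path. The man's path is written as the
  sum, over all legs, of the time already spent on the leg times its direction. This gives the
  speed limit and the dependence on the past without any case analysis on
  the current leg.
\<close>

section \<open>Running straight away from a pursuer\<close>

definition unit_speed :: "(real \<Rightarrow> 'a::metric_space) \<Rightarrow> bool"
  where "unit_speed l \<longleftrightarrow> (\<forall>s\<ge>0. \<forall>t\<ge>0. dist (l s) (l t) \<le> \<bar>s - t\<bar>)"

lemma unit_speedD: "unit_speed l \<Longrightarrow> 0 \<le> s \<Longrightarrow> 0 \<le> t \<Longrightarrow> dist (l s) (l t) \<le> \<bar>s - t\<bar>"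
  by (auto simp: unit_speed_def)

lemma norm_diff_scaleR_unit:
  fixes x u :: "'a::real_inner"
  assumes "norm u = 1"
  shows "(norm (x - c *\<^sub>R u))\<^sup>2 = (norm x)\<^sup>2 - 2 * (c * (x \<bullet> u)) + c\<^sup>2"
proof -
  have "u \<bullet> u = 1"
    using assms by (simp add: norm_eq_1)
  then show ?thesis
    by (simp only: power2_norm_eq_inner inner_diff inner_scaleR_left inner_scaleR_right)
      (simp add: inner_commute power2_eq_square right_diff_distrib)
qed

text \<open>
  At time \<open>\<tau>\<close> of the run the distance from \<open>p + \<tau> u\<close> to the pursuer's starting point exceeds
  \<open>\<tau>\<close>, since the vector from that point to \<open>p\<close> is nonzero and makes no obtuse angle
  with \<open>u\<close>.
\<close>
lemma straight_run_avoids: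
  fixes l :: "real \<Rightarrow> 'a::real_inner"
  assumes l: "unit_speed l" and u: "norm u = 1" and behind: "(l a - p) \<bullet> u \<le> 0"
    and ne: "l a \<noteq> p" and "0 \<le> a" "0 \<le> \<tau>"
  shows "l (a + \<tau>) \<noteq> p + \<tau> *\<^sub>R u"
proof
  assume caught: "l (a + \<tau>) = p + \<tau> *\<^sub>R u"
  have "norm ((l a - p) - \<tau> *\<^sub>R u) \<le> \<tau>"
    using unit_speedD[OF l, of a "a + \<tau>"] assms caught by (simp add: dist_norm diff_diff_eq)
  then have "(norm ((l a - p) - \<tau> *\<^sub>R u))\<^sup>2 \<le> \<tau>\<^sup>2"
    by (simp add: power_mono)
  moreover note norm_diff_scaleR_unit[OF u, of "l a - p" \<tau>]
  moreover have "\<tau> * ((l a - p) \<bullet> u) \<le> 0"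
    using behind \<open>0 \<le> \<tau>\<close> by (rule mult_nonneg_nonpos[rotated])
  moreover have "(norm (l a - p))\<^sup>2 > 0"
    using ne by simp
  ultimately show False by linarith
qed

text \<open>Only the straight path covers the distance \<open>t\<close> in time \<open>t\<close>.\<close>
lemma unit_speed_ray_unique:
  fixes l :: "real \<Rightarrow> 'a::real_inner"
  assumes l: "unit_speed l" and "l 0 = 0" and u: "norm u = 1" and lt: "l t = t *\<^sub>R u"
    and s: "0 \<le> s" "s \<le> t"
  shows "l s = s *\<^sub>R u"
proof -
  have 1: "norm (l s) \<le> s"
    using unit_speedD[OF l, of s 0] assms by simp
  have "norm (t *\<^sub>R u - l s) \<le> t - s"
    using unit_speedD[OF l, of t s] assms by (simp add: dist_norm)
  then have "(t *\<^sub>R u - l s) \<bullet> u \<le> t - s"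
    using norm_cauchy_schwarz[of "t *\<^sub>R u - l s" u] u by simp
  then have 2: "s \<le> l s \<bullet> u"
    using u by (simp add: inner_diff norm_eq_1)
  have "(norm (l s - s *\<^sub>R u))\<^sup>2 = (norm (l s))\<^sup>2 - 2 * (s * (l s \<bullet> u)) + s\<^sup>2"
    by (rule norm_diff_scaleR_unit[OF u])
  also have "\<dots> \<le> s\<^sup>2 - 2 * (s * s) + s\<^sup>2"
    using 1 2 s by (intro add_mono diff_mono mult_left_mono power_mono) auto
  also have "\<dots> = 0"
    by (simp add: power2_eq_square)
  finally show ?thesis by simp
qed

definition first_heading :: "'a::euclidean_space \<Rightarrow> (real \<Rightarrow> 'a) \<Rightarrow> 'a"
  where "first_heading e l = (if \<exists>\<delta>>0. \<forall>s\<in>{0..\<delta>}. l s = s *\<^sub>R e then - e else e)"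

lemma norm_first_heading: "norm (first_heading e l) = norm e"
  by (simp add: first_heading_def)

text \<open>
  The heading depends on the germ at 0 only, which is known at every positive time.
\<close>
lemma first_heading_cong:
  assumes "agree_upto t l l'" "0 < t"
  shows "first_heading e l = first_heading e l'"
proof -
  have *: "\<exists>\<delta>>0. \<forall>s\<in>{0..\<delta>}. h s = s *\<^sub>R e"
    if "agree_upto t g h" and g: "\<exists>\<delta>>0. \<forall>s\<in>{0..\<delta>}. g s = s *\<^sub>R e" for g h
  proof -
    obtain \<delta> where "\<delta> > 0" "\<forall>s\<in>{0..\<delta>}. g s = s *\<^sub>R e"
      using g by blast
    moreover have "h s = g s" if "s \<in> {0..t}" for s
      using \<open>agree_upto t g h\<close> that by (simp add: agree_upto_def)
    ultimately show ?thesis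
      using \<open>0 < t\<close> by (intro exI[of _ "min \<delta> t"]) auto
  qed
  have "agree_upto t l' l"
    using assms by (simp add: agree_upto_def)
  then show ?thesis
    using *[of l l'] *[of l' l] assms(1) unfolding first_heading_def by metis
qed

lemma first_heading_avoids:
  assumes l: "unit_speed l" and l0: "l 0 = 0" and e: "norm e = 1" and "0 < t"
  shows "l t \<noteq> t *\<^sub>R first_heading e l"
proof
  assume caught: "l t = t *\<^sub>R first_heading e l"
  have ray: "l s = s *\<^sub>R first_heading e l" if "0 \<le> s" "s \<le> t" for s
    using unit_speed_ray_unique[OF l l0 _ caught that] e by (simp add: norm_first_heading)
  show False
  proof (cases "\<exists>\<delta>>0. \<forall>s\<in>{0..\<delta>}. l s = s *\<^sub>R e")
    case True
    then obtain \<delta> where \<delta>: "\<delta> > 0" "\<forall>s\<in>{0..\<delta>}. l s = s *\<^sub>R e"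
      by blast
    have "first_heading e l = - e"
      using True by (simp add: first_heading_def)
    then have "min \<delta> t *\<^sub>R e = min \<delta> t *\<^sub>R (- e)"
      using ray[of "min \<delta> t"] \<delta> \<open>0 < t\<close> by auto
    then have "e = - e"
      using \<delta>(1) \<open>0 < t\<close> by (simp only: scaleR_left_imp_eq scaleR_cancel_left) auto
    then have "2 *\<^sub>R e = 0"
      by (metis eq_neg_iff_add_eq_0 scaleR_2)
    then show False
      using e by simp
  next
    case False
    then have "first_heading e l = e"
      by (auto simp: first_heading_def)
    then have "\<forall>s\<in>{0..t}. l s = s *\<^sub>R e"
      using ray by auto
    then show False
      using False \<open>0 < t\<close> by blast
  qed
qed

section \<open>The timetable of the legs\<close>

text \<open>
  The shift by 2 keeps the sum of the squares, here \<open>\<pi>\<^sup>2 / 6 - 1\<close>, below the squared radius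
  of the disc.
\<close>
definition leg_length :: "nat \<Rightarrow> real"
  where "leg_length n = 1 / (real n + 2)"

definition leg_start :: "nat \<Rightarrow> real"
  where "leg_start n = (\<Sum>i<n. leg_length i)"

definition time_on_leg :: "nat \<Rightarrow> real \<Rightarrow> real"
  where "time_on_leg n t = max 0 (min (leg_length n) (t - leg_start n))"

lemma leg_length_pos: "0 < leg_length n"
  by (simp add: leg_length_def)

lemma leg_start_0 [simp]: "leg_start 0 = 0"
  by (simp add: leg_start_def)

lemma leg_start_Suc: "leg_start (Suc n) = leg_start n + leg_length n"
  by (simp add: leg_start_def)

lemma leg_start_strict_mono: "strict_mono leg_start"
  by (rule strict_monoI_Suc) (simp add: leg_start_Suc leg_length_pos)

lemma leg_start_mono: "m \<le> n \<Longrightarrow> leg_start m \<le> leg_start n"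
  using leg_start_strict_mono by (simp add: strict_mono_less_eq)

lemma leg_start_nonneg: "0 \<le> leg_start n"
  using leg_start_mono[of 0 n] by simp

lemma leg_start_unbounded: "\<exists>n. t < leg_start n"
proof -
  have "\<not> summable (\<lambda>n. inverse (real n))"
    using not_summable_harmonic by (simp add: inverse_eq_divide)
  then have "\<not> summable leg_length"
    using summable_iff_shift[of "\<lambda>n. inverse (real n)" 2]
    by (simp add: leg_length_def[abs_def] inverse_eq_divide add.commute)
  then have "\<not> (\<forall>n. leg_start n \<le> t)"
    using leg_length_pos unfolding leg_start_def
    by (meson bounded_imp_summable less_imp_le lessThan_Suc_atMost summableI_nonneg_bounded)
  then show ?thesis
    by (auto simp: not_le)
qed

lemma current_leg:
  assumes "0 < t"
  obtains n where "leg_start n < t" "t \<le> leg_start (Suc n)"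
proof -
  define N where "N = (LEAST n. t \<le> leg_start n)"
  have N: "t \<le> leg_start N"
    unfolding N_def using leg_start_unbounded[of t] by (meson LeastI less_imp_le)
  with assms obtain n where n: "N = Suc n"
    by (cases N) auto
  then have "\<not> t \<le> leg_start n"
    unfolding N_def by (metis lessI not_less_Least)
  then show thesis
    using that[of n] N n by simp
qed

lemma sum_leg_length_squares: "(\<Sum>i<n. (leg_length i)\<^sup>2) \<le> 1 - 1 / (real n + 1)"
proof (induction n)
  case (Suc n)
  \<comment> \<open>The bound telescopes, as \<open>1 / (n + 2)\<^sup>2 \<le> 1 / (n + 1) - 1 / (n + 2)\<close>.\<close>
  have "(leg_length n)\<^sup>2 \<le> 1 / (real n + 1) - 1 / (real n + 2)"
    by (simp add: leg_length_def power2_eq_square divide_simps)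
  with Suc show ?case by (simp add: add.commute)
qed simp

lemma time_on_leg_mono: "s \<le> t \<Longrightarrow> time_on_leg n s \<le> time_on_leg n t"
  by (auto simp: time_on_leg_def)

lemma time_on_leg_before: "t \<le> leg_start n \<Longrightarrow> time_on_leg n t = 0"
  by (simp add: time_on_leg_def)

lemma time_on_leg_after: "leg_start (Suc n) \<le> t \<Longrightarrow> time_on_leg n t = leg_length n"
  using leg_length_pos[of n] by (auto simp: time_on_leg_def leg_start_Suc)

lemma time_on_leg_during:
  "leg_start n \<le> t \<Longrightarrow> t \<le> leg_start (Suc n) \<Longrightarrow> time_on_leg n t = t - leg_start n"
  by (auto simp: time_on_leg_def leg_start_Suc)

lemma sum_time_on_leg:
  assumes "0 \<le> t"
  shows "(\<Sum>i<n. time_on_leg i t) = min t (leg_start n)"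
  using assms
proof (induction n)
  case (Suc n)
  then show ?case
    using leg_length_pos[of n] by (auto simp: time_on_leg_def leg_start_Suc min_def max_def)
qed simp

section \<open>The polygonal path with given headings\<close>

text \<open>
  Headings take the corner where the leg begins as an argument, so that they can be chosen
  orthogonal to it although the corners are themselves determined by the earlier headings.
\<close>
primrec corner :: "(nat \<Rightarrow> 'a \<Rightarrow> 'a) \<Rightarrow> nat \<Rightarrow> 'a::euclidean_space"
  where
    "corner h 0 = 0"
  | "corner h (Suc n) = corner h n + leg_length n *\<^sub>R h n (corner h n)"

definition legs_path :: "(nat \<Rightarrow> 'a \<Rightarrow> 'a) \<Rightarrow> real \<Rightarrow> 'a::euclidean_space"
  where "legs_path h t = (\<Sum>i | leg_start i < t. time_on_leg i t *\<^sub>R h i (corner h i))"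

lemma legs_path_eq_sum:
  assumes "t \<le> leg_start N"
  shows "legs_path h t = (\<Sum>i<N. time_on_leg i t *\<^sub>R h i (corner h i))"
  unfolding legs_path_def
proof (rule sum.mono_neutral_left)
  show "{i. leg_start i < t} \<subseteq> {..<N}"
    using assms leg_start_mono by (fastforce simp: not_less[symmetric])
  show "\<forall>i\<in>{..<N} - {i. leg_start i < t}. time_on_leg i t *\<^sub>R h i (corner h i) = 0"
    by (simp add: time_on_leg_before)
qed simp

lemma corner_eq_sum: "corner h n = (\<Sum>i<n. leg_length i *\<^sub>R h i (corner h i))"
  by (induction n) simp_all

lemma legs_path_on_leg:
  assumes "leg_start n \<le> t" "t \<le> leg_start (Suc n)"
  shows "legs_path h t = corner h n + (t - leg_start n) *\<^sub>R h n (corner h n)"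
proof -
  have "time_on_leg i t = leg_length i" if "i < n" for i
    using that assms leg_start_mono[of "Suc i" n] by (simp add: time_on_leg_after)
  then show ?thesis
    using assms by (simp add: legs_path_eq_sum[of t "Suc n"] time_on_leg_during corner_eq_sum[of h n])
qed

lemma legs_path_0: "legs_path h 0 = 0"
  by (simp add: legs_path_eq_sum[of 0 0])

lemma legs_path_unit_speed:
  assumes h: "\<And>n p. norm (h n p) = 1"
  shows "unit_speed (legs_path h)"
proof -
  have le: "dist (legs_path h s) (legs_path h t) \<le> t - s" if "0 \<le> s" "s \<le> t" for s t
  proof -
    obtain N where N: "t < leg_start N"
      using leg_start_unbounded by blast
    have "legs_path h t - legs_path h s
        = (\<Sum>i<N. (time_on_leg i t - time_on_leg i s) *\<^sub>R h i (corner h i))"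
      using N that by (simp add: legs_path_eq_sum[of _ N] sum_subtractf scaleR_diff_left)
    also have "norm \<dots> \<le> (\<Sum>i<N. time_on_leg i t - time_on_leg i s)"
      using time_on_leg_mono[OF \<open>s \<le> t\<close>] by (intro sum_norm_le) (simp add: h)
    also have "\<dots> = t - s"
      using N that by (simp add: sum_subtractf sum_time_on_leg)
    finally show ?thesis
      by (simp add: dist_norm norm_minus_commute)
  qed
  have "dist (legs_path h s) (legs_path h t) \<le> \<bar>s - t\<bar>" if "0 \<le> s" "0 \<le> t" for s t
    using le[of s t] le[of t s] that by (cases "s \<le> t") (auto simp: dist_commute)
  then show ?thesis
    by (simp add: unit_speed_def)
qed

text \<open>By Pythagoras, each leg adds at most the square of its length to the squared distance.\<close>
lemma norm_legs_path_le_1: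
  assumes h: "\<And>n p. norm (h n p) = 1" and perp: "\<And>n. corner h n \<bullet> h n (corner h n) = 0"
    and "0 \<le> t"
  shows "norm (legs_path h t) \<le> 1"
proof -
  have pyth: "(norm (corner h n + x *\<^sub>R h n (corner h n)))\<^sup>2 = (norm (corner h n))\<^sup>2 + x\<^sup>2" for n x
    using norm_add_Pythagorean[of "corner h n" "x *\<^sub>R h n (corner h n)"] perp[of n]
    by (simp add: orthogonal_def h)
  have corner: "(norm (corner h n))\<^sup>2 = (\<Sum>i<n. (leg_length i)\<^sup>2)" for n
    by (induction n) (simp_all add: pyth)
  show ?thesis
  proof (cases "t = 0")
    case False
    then have "0 < t"
      using \<open>0 \<le> t\<close> by simp
    then obtain n where n: "leg_start n < t" "t \<le> leg_start (Suc n)"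
      by (rule current_leg)
    have "(norm (legs_path h t))\<^sup>2 = (\<Sum>i<n. (leg_length i)\<^sup>2) + (t - leg_start n)\<^sup>2"
      using n by (simp add: legs_path_on_leg[of n] pyth corner)
    also have "\<dots> \<le> (\<Sum>i<Suc n. (leg_length i)\<^sup>2)"
      using n by (simp add: leg_start_Suc power_mono)
    also have "\<dots> \<le> 1"
      using sum_leg_length_squares[of "Suc n"]
      by (smt (verit) divide_nonneg_nonneg of_nat_0_le_iff)
    finally show ?thesis
      by (simp add: power_le_one_iff abs_square_le_1)
  qed (simp add: legs_path_0)
qed

lemma legs_path_cong:
  assumes "\<And>i p. leg_start i < t \<Longrightarrow> h i p = h' i p"
  shows "legs_path h t = legs_path h' t"
proof -
  have "corner h i = corner h' i" if "leg_start i < t" for i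
    using that
  proof (induction i)
    case (Suc i)
    then have "leg_start i < t"
      using leg_length_pos[of i] by (simp add: leg_start_Suc)
    with Suc assms show ?case by simp
  qed simp
  then show ?thesis
    unfolding legs_path_def using assms by (intro sum.cong) auto
qed

section \<open>The escape path\<close>

text \<open>
  As \<open>u\<close> is orthogonal to \<open>p\<close>, the last conjunct says that \<open>q\<close> lies behind a runner who leaves
  \<open>p\<close> in direction \<open>u\<close>.
\<close>
definition evading_heading :: "'a::euclidean_space \<Rightarrow> 'a \<Rightarrow> 'a"
  where "evading_heading p q = (SOME u. norm u = 1 \<and> p \<bullet> u = 0 \<and> q \<bullet> u \<le> 0)"

lemma evading_heading:
  fixes p q :: "'a::euclidean_space"
  assumes "2 \<le> DIM('a)"
  shows "norm (evading_heading p q) = 1" "p \<bullet> evading_heading p q = 0"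
    "q \<bullet> evading_heading p q \<le> 0"
proof -
  obtain y where y: "y \<noteq> 0" "orthogonal p y"
    using orthogonal_to_vector_exists[OF assms] by metis
  define v where "v = (if q \<bullet> y \<le> 0 then sgn y else - sgn y)"
  have "norm v = 1 \<and> p \<bullet> v = 0 \<and> q \<bullet> v \<le> 0"
    using y by (auto simp: v_def norm_sgn orthogonal_def sgn_div_norm mult_le_0_iff zero_le_mult_iff)
  then have "norm (evading_heading p q) = 1 \<and> p \<bullet> evading_heading p q = 0
      \<and> q \<bullet> evading_heading p q \<le> 0"
    unfolding evading_heading_def by (rule someI)
  then show "norm (evading_heading p q) = 1" "p \<bullet> evading_heading p q = 0"
    "q \<bullet> evading_heading p q \<le> 0"
    by auto
qed

definition escape_heading :: "'a::euclidean_space \<Rightarrow> (real \<Rightarrow> 'a) \<Rightarrow> nat \<Rightarrow> 'a \<Rightarrow> 'a"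
  where "escape_heading e l n p =
    (if n = 0 then first_heading e l else evading_heading p (l (leg_start n)))"

definition escape_path :: "'a::euclidean_space \<Rightarrow> (real \<Rightarrow> 'a) \<Rightarrow> real \<Rightarrow> 'a"
  where "escape_path e l = legs_path (escape_heading e l)"

lemma escape_path_in_ball:
  fixes e :: "'a::euclidean_space"
  assumes "2 \<le> DIM('a)" "norm e = 1"
  shows "unit_speed (escape_path e l)" and "0 \<le> t \<Longrightarrow> norm (escape_path e l t) \<le> 1"
proof -
  have unit: "norm (escape_heading e l n p) = 1" for n p
    using assms by (simp add: escape_heading_def norm_first_heading evading_heading)
  show "unit_speed (escape_path e l)"
    unfolding escape_path_def using unit by (rule legs_path_unit_speed)
  have "corner (escape_heading e l) n \<bullet> escape_heading e l n (corner (escape_heading e l) n) = 0" for n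
    using assms by (cases n) (simp_all add: escape_heading_def evading_heading del: corner.simps(2))
  then show "norm (escape_path e l t) \<le> 1" if "0 \<le> t"
    unfolding escape_path_def using unit that by (intro norm_legs_path_le_1)
qed

lemma escape_path_non_anticipating:
  assumes "agree_upto t l l'"
  shows "agree_upto t (escape_path e l) (escape_path e l')"
proof -
  have "escape_path e l s = escape_path e l' s" if s: "s \<in> {0..t}" for s
    unfolding escape_path_def
  proof (rule legs_path_cong)
    fix i p
    assume i: "leg_start i < s"
    then have "0 < t"
      using s leg_start_nonneg[of i] by simp
    moreover have "l (leg_start i) = l' (leg_start i)"
      using assms i s leg_start_nonneg[of i] by (simp add: agree_upto_def)
    ultimately show "escape_heading e l i p = escape_heading e l' i p"
      using first_heading_cong[OF assms] by (simp add: escape_heading_def)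
  qed
  then show ?thesis
    by (simp add: agree_upto_def)
qed

text \<open>
  A pursuer with the same starting point is shaken off at once by the choice of the first
  heading. From then on, avoiding him on one leg provides the distinct positions needed at the
  start of the next.
\<close>
lemma escape_path_avoids:
  fixes l :: "real \<Rightarrow> 'a::euclidean_space"
  assumes dim: "2 \<le> DIM('a)" and e: "norm e = 1" and l: "unit_speed l" and l0: "l 0 = 0" and "0 < t"
  shows "escape_path e l t \<noteq> l t"
proof -
  have "escape_path e l s \<noteq> l s" if "leg_start n < s" "s \<le> leg_start (Suc n)" for n s
    using that
  proof (induction n arbitrary: s)
    case 0
    then have "escape_path e l s = s *\<^sub>R first_heading e l"
      by (simp add: escape_path_def legs_path_on_leg[of 0] escape_heading_def)
    then show ?case
      using first_heading_avoids[OF l l0 e, of s] 0 by simp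
  next
    case (Suc n)
    define a where "a = leg_start (Suc n)"
    define p where "p = corner (escape_heading e l) (Suc n)"
    have path: "escape_path e l r = p + (r - a) *\<^sub>R evading_heading p (l a)"
      if "a \<le> r" "r \<le> leg_start (Suc (Suc n))" for r
      using that unfolding escape_path_def p_def a_def
      by (subst legs_path_on_leg[of "Suc n"]) (simp_all add: escape_heading_def del: corner.simps(2))
    have a: "leg_start n < a" "a \<le> s" "0 \<le> a"
      using Suc.prems leg_length_pos[of n] leg_start_nonneg[of n] by (auto simp: a_def leg_start_Suc)
    have "escape_path e l a = p"
      using path[of a] a Suc.prems by simp
    then have "l a \<noteq> p"
      using Suc.IH[of a] a by (auto simp: a_def)
    moreover have "(l a - p) \<bullet> evading_heading p (l a) \<le> 0"
      using evading_heading(2,3)[OF dim, where p = p and q = "l a"] by (simp add: inner_diff_left)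
    ultimately have "l (a + (s - a)) \<noteq> p + (s - a) *\<^sub>R evading_heading p (l a)"
      using a by (intro straight_run_avoids l evading_heading dim) auto
    then show ?case
      using path[of s] a Suc.prems by auto
  qed
  then show ?thesis
    using current_leg[OF \<open>0 < t\<close>] by metis
qed

section \<open>Winning strategies for both players\<close>

lemma game_paths_linf_iff:
  fixes l :: "real \<Rightarrow> 'a::metric_space \<times> 'b::metric_space"
  shows "l \<in> game_paths (A \<times> B) (linf_dist dist dist) p \<longleftrightarrow>
    l \<in> extensional {0..} \<and> (\<forall>t\<ge>0. fst (l t) \<in> A \<and> snd (l t) \<in> B) \<and> l 0 = p
    \<and> unit_speed (\<lambda>t. fst (l t)) \<and> unit_speed (\<lambda>t. snd (l t))"
  unfolding game_paths_def unit_speed_def linf_dist_def PiE_iff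
  by (auto simp: mem_Times_iff)

lemma lion_wins:
  fixes A :: "'a::metric_space set"
  shows "\<exists>G. winning_lion_strategy (A \<times> {0..1 :: real}) (linf_dist dist dist) (c, 1) (c, 0) G"
proof -
  define G where
    "G m = restrict (\<lambda>t. (fst (m t), max 0 (1 - t))) {0..}" for m :: "real \<Rightarrow> 'a \<times> real"
  let ?L = "game_paths (A \<times> {0..1 :: real}) (linf_dist dist dist) (c, 1)"
  let ?M = "game_paths (A \<times> {0..1 :: real}) (linf_dist dist dist) (c, 0)"
  have "G m \<in> ?L" if "m \<in> ?M" for m
    using that unfolding game_paths_linf_iff by (auto simp: G_def unit_speed_def dist_real_def)
  moreover have "non_anticipating ?M G"
    by (auto simp: non_anticipating_def agree_upto_def G_def)
  moreover have "\<exists>t\<ge>0. G m t = m t" if m: "m \<in> ?M" for m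
  proof -
    have speed: "\<forall>s\<ge>0. \<forall>t\<ge>0. dist (snd (m s)) (snd (m t)) \<le> \<bar>s - t\<bar>"
      and m0: "snd (m 0) = 0" and m1: "0 \<le> snd (m 1)"
      using m unfolding game_paths_linf_iff unit_speed_def by auto
    have "1-lipschitz_on {0..} (\<lambda>t. snd (m t))"
      using speed by (auto simp: lipschitz_on_def dist_real_def)
    then have "continuous_on {0..1} (\<lambda>t. snd (m t))"
      by (rule continuous_on_subset[OF lipschitz_on_continuous_on]) auto
    then have "\<exists>t. 0 \<le> t \<and> t \<le> 1 \<and> snd (m t) + t = 1"
      using m0 m1 by (intro IVT'[of "\<lambda>t. snd (m t) + t" 0 1 1]) (auto intro!: continuous_intros)
    then obtain t where "0 \<le> t" "t \<le> 1" "snd (m t) = 1 - t"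
      by force
    then show ?thesis
      by (intro exI[of _ t]) (simp add: G_def prod_eq_iff)
  qed
  ultimately have "winning_lion_strategy (A \<times> {0..1 :: real}) (linf_dist dist dist) (c, 1) (c, 0) G"
    by (simp add: winning_lion_strategy_def lion_strategy_def)
  then show ?thesis by blast
qed

lemma man_wins:
  assumes dim: "2 \<le> DIM('a::euclidean_space)"
  shows "\<exists>F. winning_man_strategy (cball (0 :: 'a) 1 \<times> {0..1 :: real}) (linf_dist dist dist)
    (0, 1) (0, 0) F"
proof -
  obtain e :: 'a where e: "norm e = 1"
    by (rule vector_choose_size[of 1]) simp_all
  define F where
    "F l = restrict (\<lambda>t. (escape_path e (\<lambda>t. fst (l t)) t, 0 :: real)) {0..}" for l :: "real \<Rightarrow> 'a \<times> real"
  let ?L = "game_paths (cball (0 :: 'a) 1 \<times> {0..1 :: real}) (linf_dist dist dist) (0, 1)"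
  let ?M = "game_paths (cball (0 :: 'a) 1 \<times> {0..1 :: real}) (linf_dist dist dist) (0, 0)"
  have "F l \<in> ?M" for l
    using escape_path_in_ball[OF dim e, where l = "\<lambda>t. fst (l t)"]
    unfolding game_paths_linf_iff
    by (auto simp: F_def unit_speed_def escape_path_def legs_path_0)
  moreover have "non_anticipating ?L F"
  proof -
    have "agree_upto t (F l) (F l')" if "agree_upto t l l'" for t l l'
      using escape_path_non_anticipating[of t "\<lambda>t. fst (l t)" "\<lambda>t. fst (l' t)" e] that
      by (simp add: agree_upto_def F_def)
    then show ?thesis
      by (simp add: non_anticipating_def)
  qed
  moreover have "F l t \<noteq> l t" if l: "l \<in> ?L" and "0 \<le> t" for l t
  proof (cases "t = 0")
    case True
    then show ?thesis
      using l by (auto simp: game_paths_linf_iff F_def)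
  next
    case False
    then have "escape_path e (\<lambda>t. fst (l t)) t \<noteq> fst (l t)"
      using l \<open>0 \<le> t\<close> by (intro escape_path_avoids[OF dim e]) (auto simp: game_paths_linf_iff)
    then show ?thesis
      using \<open>0 \<le> t\<close> by (auto simp: F_def prod_eq_iff)
  qed
  ultimately have "winning_man_strategy (cball (0 :: 'a) 1 \<times> {0..1 :: real}) (linf_dist dist dist)
      (0, 1) (0, 0) F"
    by (simp add: winning_man_strategy_def man_strategy_def)
  then show ?thesis by blast
qed

theorem theorem8:
  shows "(\<exists>G. winning_lion_strategy (cball (0 :: real ^ 2) 1 \<times> {0..1 :: real}) (linf_dist dist dist)
                (0, 1) (0, 0) G) \<and>
         (\<exists>F. winning_man_strategy (cball (0 :: real ^ 2) 1 \<times> {0..1 :: real}) (linf_dist dist dist)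
                (0, 1) (0, 0) F)"
  using lion_wins[of "cball (0 :: real ^ 2) 1" 0] man_wins[where 'a = "real ^ 2"] by simp

end
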